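(* Let $m,p\in\mathbb{N}_0$, let the real parameters $A=((a_i,\alpha_i))_{1\le i\le p}$, $B=((b_j,\beta_j))_{1\le j\le m}$ satisfy the parameter assumptions (1)-(4) of the context, and let $\{X_t^{\mathbb{H},A,B},\,t\ge0\}$, $\mathbb{H}\in(0,1)$, be the generalized Fox-$H$ process on $(\mathcal{S}',\mathcal{C}_\sigma(\mathcal{S}'),\mu_\Psi)$. Then $X^{\mathbb{H},A,B}$ exhibits sub-diffusion for $\mathbb{H}\in(0,1/2)$, normal diffusion for $\mathbb{H}=1/2$, and super-diffusion for $\mathbb{H}\in(1/2,1)$.
   Context: **Diffusion types.** A process $X$ exhibits sub-diffusion, normal diffusion, or super-diffusion if its variance $\mathrm{Var}(X_t)$ grows, as $t\to\infty$, respectively slower than linearly ($\mathrm{Var}(X_t)/t\to0$), linearly ($\mathrm{Var}(X_t)/t\to c\in(0,\infty)$), or faster than linearly ($\mathrm{Var}(X_t)/t\to\infty$). **Parameter assumptions.** $m,p\in\mathbb{N}_0$ and: (1) $a_i\in\mathbb{R}$, $\alpha_i>0$, $a_i+\alpha_i>0$ for $i=1,\dots,p$; (2) $b_j\in\mathbb{R}$, $\beta_j>0$, $b_j+\beta_j>0$ for $j=1,\dots,m$; (3) with $a^*:=\sum_{j=1}^m\beta_j-\sum_{i=1}^p\alpha_i$ and $\mu:=\sum_{j=1}^m b_j-\sum_{i=1}^p a_i+(p-m)/2$, either $a^*>0$, or $a^*=0$ and $\mu<-1$; (4) the Fox-$H$ function $$H^{m,0}_{p,m}(\tau):=\frac{1}{2\pi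 \mathrm{i}}\int_{\gamma-\mathrm{i}\infty}^{\gamma+\mathrm{i}\infty}\frac{\prod_{j=1}^m\Gamma(b_j+\beta_js)}{\prod_{i=1}^p\Gamma(a_i+\alpha_is)}\,\tau^{-s}\,\mathrm{d}s,\quad \tau>0,$$ (with $\gamma>\max_j(-b_j/\beta_j)$, e.g. $\gamma=1$) is non-negative on $(0,\infty)$. Empty sums are $0$, empty products are $1$. Put $K=\prod_{j=1}^m\Gamma(b_j+\beta_j)/\prod_{i=1}^p\Gamma(a_i+\alpha_i)$. Known fact: under these assumptions $\varrho_H:=\frac1K H^{m,0}_{p,m}$ is a probability density on $(0,\infty)$ with $\int_0^\infty\tau^l\varrho_H(\tau)\,\mathrm{d}\tau=\frac1K\prod_j\Gamma(b_j+\beta_j(l+1))/\prod_i\Gamma(a_i+\alpha_i(l+1))$, $l\in\mathbb{N}_0$, and Laplace transform $s\mapsto\frac1K\,{}_m\Psi_p(-s)$, $s\ge0$. **Generalized Wright function.** ${}_m\Psi_p(z):=\sum_{k\ge0}\frac{\prod_{j=1}^m\Gamma(b_j+\beta_j+\beta_jk)}{\prod_{i=1}^p\Gamma(a_i+\alpha_i+\alpha_ik)}\frac{z^k}{k!}$ (entire if $a^*<1$). For $s>0$, in general, ${}_m\Psi_p(-s)$ is understood through its Fox-$H$ representation ${}_m\Psi_p(-s)=\frac{1}{2\pi \mathrm{i}}\int_{c-\mathrm{i}\infty}^{c+\mathrm{i}\infty}\Gamma(u)\frac{\prod_j\Gamma(b_j+\beta_j-\beta_ju)}{\prod_i\Gamma(a_i+\alpha_i-\alpha_iu)}s^{-u}\,\mathrm{d}u$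 with $0<c<\min_j(b_j+\beta_j)/\beta_j$, and ${}_m\Psi_p(0)=K$. **The measure.** Let $\mathcal{S}=\mathcal{S}(\mathbb{R})$ be the real Schwartz space, $\mathcal{S}'$ its dual with pairing $\langle\cdot,\cdot\rangle$ extending the inner product of $L^2(\mathbb{R},\mathrm{d}x)$, and $\mathcal{C}_\sigma(\mathcal{S}')$ the cylinder $\sigma$-algebra. The generalized Fox-$H$ measure $\mu_\Psi$ is the unique probability measure on $(\mathcal{S}',\mathcal{C}_\sigma(\mathcal{S}'))$ with $\int_{\mathcal{S}'}e^{\mathrm{i}\langle\omega,\varphi\rangle}\,\mathrm{d}\mu_\Psi(\omega)=\frac1K\,{}_m\Psi_p\big(-\frac12\langle\varphi,\varphi\rangle\big)$, $\varphi\in\mathcal{S}$. One has $\|\langle\cdot,\varphi\rangle\|_{L^2(\mu_\Psi)}=c\,|\varphi|_{L^2(\mathbb{R})}$ for a constant $c$; hence $\langle\cdot,f\rangle\in L^2(\mu_\Psi)$ is defined for $f\in L^2(\mathbb{R})$ by $L^2(\mu_\Psi)$-limits. **Fractional operator.** $M_-^{\mathbb{H}}f=K_{\mathbb{H}}D_-^{1/2-\mathbb{H}}f$ if $\mathbb{H}<1/2$, $M_-^{1/2}f=f$, $M_-^{\mathbb{H}}f=K_{\mathbb{H}}I_-^{\mathbb{H}-1/2}f$ if $\mathbb{H}>1/2$, where for $\sigma\in(0,1)$ $(I_-^\sigma f)(x)=\frac{1}{\Gamma(\sigma)}\int_x^\infty f(t)(t-x)^{\sigma-1}\mathrm{d}t$,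 $(D_-^\sigma f)(x)=-\frac{1}{\Gamma(1-\sigma)}\frac{\mathrm{d}}{\mathrm{d}x}\int_x^\infty f(t)(t-x)^{-\sigma}\mathrm{d}t$, and $K_{\mathbb{H}}=\Gamma(\mathbb{H}+\tfrac12)\big(\int_0^\infty((1+s)^{\mathbb{H}-1/2}-s^{\mathbb{H}-1/2})^2\mathrm{d}s+\frac{1}{2\mathbb{H}}\big)^{-1/2}$. Known: $M_-^{\mathbb{H}}\mathbf{1}_{[0,t)}\in L^2(\mathbb{R})$ and $(M_-^{\mathbb{H}}\mathbf{1}_{[0,t)},M_-^{\mathbb{H}}\mathbf{1}_{[0,s)})_{L^2}=\frac12(t^{2\mathbb{H}}+s^{2\mathbb{H}}-|t-s|^{2\mathbb{H}})$. **Generalized Fox-$H$ process.** $X_t^{\mathbb{H},A,B}:=\langle\cdot,M_-^{\mathbb{H}}\mathbf{1}_{[0,t)}\rangle$, $t\ge0$. *)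

theory Defs
  imports "HOL-Probability.Probability"
begin

text \<open>
  The parameters \<open>A = ((a\<^sub>i, \<alpha>\<^sub>i))\<^sub>i\<close> and \<open>B = ((b\<^sub>j, \<beta>\<^sub>j))\<^sub>j\<close> are lists of pairs,
  with \<open>p = length A\<close> and \<open>m = length B\<close>.
\<close>

section \<open>Fox-H function and generalized Wright function\<close>

text \<open>
  Where a denominator factor has a pole, \<open>1 / Gamma\<close> is mathematically \<open>0\<close>; this agrees with
  the conventions \<open>Gamma z = 0\<close> at a pole \<open>z\<close> and \<open>x / 0 = 0\<close>.
\<close>

definition gamma_ratio :: "(real \<times> real) list \<Rightarrow> (real \<times> real) list \<Rightarrow> 'a::Gamma \<Rightarrow> 'a" where
  "gamma_ratio A B s =
     (\<Prod>(b, \<beta>)\<leftarrow>B. Gamma (of_real b + of_real \<beta> * s)) /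
     (\<Prod>(a, \<alpha>)\<leftarrow>A. Gamma (of_real a + of_real \<alpha> * s))"

definition K_const :: "(real \<times> real) list \<Rightarrow> (real \<times> real) list \<Rightarrow> real" where
  "K_const A B = gamma_ratio A B 1"

text \<open>\<open>(1 / (2 \<pi> \<i>)) \<integral> F(s) ds\<close> along the line \<open>s = \<gamma> + \<i> y\<close>, so that \<open>ds = \<i> dy\<close>.\<close>

definition vertical_integral :: "real \<Rightarrow> (complex \<Rightarrow> complex) \<Rightarrow> complex" where
  "vertical_integral \<gamma> F =
     1 / (2 * of_real pi * \<i>) * (LINT y|lborel. F (Complex \<gamma> y) * \<i>)"

definition fox_H :: "(real \<times> real) list \<Rightarrow> (real \<times> real) list \<Rightarrow> real \<Rightarrow> real \<Rightarrow> complex" where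
  "fox_H A B \<gamma> \<tau> =
     vertical_integral \<gamma> (\<lambda>s. gamma_ratio A B s * of_real \<tau> powr (- s))"

text \<open>
  \<open>wright_neg A B c s\<close> is the value of the generalized Wright function at \<open>-s\<close>, for \<open>s \<ge> 0\<close>,
  through its Fox-H representation; note \<open>b + \<beta> - \<beta> u = b + \<beta> (1 - u)\<close>.
\<close>

definition wright_neg :: "(real \<times> real) list \<Rightarrow> (real \<times> real) list \<Rightarrow> real \<Rightarrow> real \<Rightarrow> complex" where
  "wright_neg A B c s =
     (if s = 0 then of_real (K_const A B)
      else vertical_integral c (\<lambda>u. Gamma u * gamma_ratio A B (1 - u) * of_real s powr (- u)))"

definition a_star :: "(real \<times> real) list \<Rightarrow> (real \<times> real) list \<Rightarrow> real" where
  "a_star A B = (\<Sum>(b, \<beta>)\<leftarrow>B. \<beta>) - (\<Sum>(a, \<alpha>)\<leftarrow>A. \<alpha>)"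

definition mu_exp :: "(real \<times> real) list \<Rightarrow> (real \<times> real) list \<Rightarrow> real" where
  "mu_exp A B = (\<Sum>(b, \<beta>)\<leftarrow>B. b) - (\<Sum>(a, \<alpha>)\<leftarrow>A. a) + (real (length A) - real (length B)) / 2"

definition admissible_line :: "(real \<times> real) list \<Rightarrow> real \<Rightarrow> bool" where
  "admissible_line B \<gamma> \<longleftrightarrow> (\<forall>(b, \<beta>)\<in>set B. \<gamma> > - b / \<beta>)"

definition admissible_wright_line :: "(real \<times> real) list \<Rightarrow> real \<Rightarrow> bool" where
  "admissible_wright_line B c \<longleftrightarrow> 0 < c \<and> (\<forall>(b, \<beta>)\<in>set B. c < (b + \<beta>) / \<beta>)"

definition fox_H_parameters :: "(real \<times> real) list \<Rightarrow> (real \<times> real) list \<Rightarrow> real \<Rightarrow> bool" where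
  "fox_H_parameters A B \<gamma> \<longleftrightarrow>
     (\<forall>(a, \<alpha>)\<in>set A. \<alpha> > 0 \<and> a + \<alpha> > 0) \<and>
     (\<forall>(b, \<beta>)\<in>set B. \<beta> > 0 \<and> b + \<beta> > 0) \<and>
     (a_star A B > 0 \<or> (a_star A B = 0 \<and> mu_exp A B < -1)) \<and>
     (\<forall>\<tau>>0. fox_H A B \<gamma> \<tau> \<in> \<real>\<^sub>\<ge>\<^sub>0)"

section \<open>Schwartz space and tempered distributions\<close>

definition schwartz :: "(real \<Rightarrow> real) set" where
  "schwartz = {f. (\<forall>n. (deriv ^^ n) f differentiable_on UNIV) \<and>
                  (\<forall>k n. bounded (range (\<lambda>x. x ^ k * (deriv ^^ n) f x)))}"

definition schwartz_seminorm :: "nat \<Rightarrow> nat \<Rightarrow> (real \<Rightarrow> real) \<Rightarrow> real" where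
  "schwartz_seminorm k n f = (SUP x. \<bar>x ^ k * (deriv ^^ n) f x\<bar>)"

definition schwartz_topology :: "(real \<Rightarrow> real) topology" where
  "schwartz_topology = topology_generated_by
     {{g \<in> schwartz. schwartz_seminorm k n (\<lambda>x. g x - f x) < \<epsilon>} | f k n \<epsilon>.
        f \<in> schwartz \<and> \<epsilon> > 0}"

text \<open>
  Functionals are taken to be \<open>extensional\<close>, so that each continuous linear functional on the
  Schwartz space has exactly one representative; the pairing is application.
\<close>

definition tempered :: "((real \<Rightarrow> real) \<Rightarrow> real) set" where
  "tempered = {\<omega> \<in> extensional schwartz.
     (\<forall>f\<in>schwartz. \<forall>g\<in>schwartz. \<forall>a b.
        \<omega> (\<lambda>x. a * f x + b * g x) = a * \<omega> f + b * \<omega> g) \<and>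
     continuous_map schwartz_topology euclideanreal \<omega>}"

definition cylinder_algebra :: "((real \<Rightarrow> real) \<Rightarrow> real) measure" where
  "cylinder_algebra = sigma tempered
     {{\<omega> \<in> tempered. (\<lambda>i\<in>{..<n}. \<omega> (\<phi> i)) \<in> S} | n \<phi> S.
        (\<forall>i<n. \<phi> i \<in> schwartz) \<and> S \<in> sets (\<Pi>\<^sub>M i\<in>{..<(n::nat)}. (borel :: real measure))}"

definition fox_H_measure ::
    "(real \<times> real) list \<Rightarrow> (real \<times> real) list \<Rightarrow> real \<Rightarrow> ((real \<Rightarrow> real) \<Rightarrow> real) measure \<Rightarrow> bool" where
  "fox_H_measure A B c M \<longleftrightarrow>
     prob_space M \<and> space M = tempered \<and> sets M = sets cylinder_algebra \<and>
     (\<forall>\<phi>\<in>schwartz.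
        (LINT \<omega>|M. exp (\<i> * of_real (\<omega> \<phi>))) =
        1 / of_real (K_const A B) * wright_neg A B c (1/2 * (LINT x|lborel. \<phi> x * \<phi> x)))"

section \<open>Extension of the pairing by mean-square limits\<close>

definition square_integrable :: "'a measure \<Rightarrow> ('a \<Rightarrow> real) \<Rightarrow> bool" where
  "square_integrable M f \<longleftrightarrow> f \<in> borel_measurable M \<and> integrable M (\<lambda>x. (f x)\<^sup>2)"

definition L2_tendsto :: "'a measure \<Rightarrow> (nat \<Rightarrow> 'a \<Rightarrow> real) \<Rightarrow> ('a \<Rightarrow> real) \<Rightarrow> bool" where
  "L2_tendsto M F f \<longleftrightarrow>
     (\<forall>n. square_integrable M (F n)) \<and> square_integrable M f \<and>
     (\<lambda>n. LINT x|M. (F n x - f x)\<^sup>2) \<longlonglongrightarrow> 0"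

text \<open>
  \<open>Y\<close> is a version of the random variable obtained by pairing with \<open>f\<close>.  As the pairing is, up
  to a constant factor, isometric on the Schwartz space, the limit does not depend
  (up to null sets) on the approximating sequence.
\<close>

definition extended_pairing ::
    "((real \<Rightarrow> real) \<Rightarrow> real) measure \<Rightarrow> (real \<Rightarrow> real) \<Rightarrow> (((real \<Rightarrow> real) \<Rightarrow> real) \<Rightarrow> real) \<Rightarrow> bool" where
  "extended_pairing M f Y \<longleftrightarrow>
     (\<exists>\<phi>. (\<forall>n. \<phi> n \<in> schwartz) \<and> L2_tendsto lborel \<phi> f \<and> L2_tendsto M (\<lambda>n \<omega>. \<omega> (\<phi> n)) Y)"

section \<open>Fractional operator and the process\<close>

definition frac_integral :: "real \<Rightarrow> (real \<Rightarrow> real) \<Rightarrow> real \<Rightarrow> real" where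
  "frac_integral \<sigma> f x = 1 / Gamma \<sigma> * (LINT t:{x<..}|lborel. f t * (t - x) powr (\<sigma> - 1))"

definition frac_deriv :: "real \<Rightarrow> (real \<Rightarrow> real) \<Rightarrow> real \<Rightarrow> real" where
  "frac_deriv \<sigma> f x =
     - 1 / Gamma (1 - \<sigma>) * deriv (\<lambda>y. LINT t:{y<..}|lborel. f t * (t - y) powr (- \<sigma>)) x"

definition K_hurst :: "real \<Rightarrow> real" where
  "K_hurst H = Gamma (H + 1/2) *
     ((LINT s:{0<..}|lborel. ((1 + s) powr (H - 1/2) - s powr (H - 1/2))\<^sup>2) + 1 / (2 * H))
       powr (- 1/2)"

definition M_minus :: "real \<Rightarrow> (real \<Rightarrow> real) \<Rightarrow> real \<Rightarrow> real" where
  "M_minus H f =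
     (if H < 1/2 then (\<lambda>x. K_hurst H * frac_deriv (1/2 - H) f x)
      else if H = 1/2 then f
      else (\<lambda>x. K_hurst H * frac_integral (H - 1/2) f x))"

definition fox_H_process ::
    "((real \<Rightarrow> real) \<Rightarrow> real) measure \<Rightarrow> real \<Rightarrow> (real \<Rightarrow> ((real \<Rightarrow> real) \<Rightarrow> real) \<Rightarrow> real) \<Rightarrow> bool" where
  "fox_H_process M H X \<longleftrightarrow>
     (\<forall>t\<ge>0. extended_pairing M (M_minus H (indicat_real {0..<t})) (X t))"

section \<open>Diffusion types\<close>

definition sub_diffusion :: "'a measure \<Rightarrow> (real \<Rightarrow> 'a \<Rightarrow> real) \<Rightarrow> bool" where
  "sub_diffusion M X \<longleftrightarrow>
     ((\<lambda>t. prob_space.variance M (X t) / t) \<longlongrightarrow> 0) at_top"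

definition normal_diffusion :: "'a measure \<Rightarrow> (real \<Rightarrow> 'a \<Rightarrow> real) \<Rightarrow> bool" where
  "normal_diffusion M X \<longleftrightarrow>
     (\<exists>c>0. ((\<lambda>t. prob_space.variance M (X t) / t) \<longlongrightarrow> c) at_top)"

definition super_diffusion :: "'a measure \<Rightarrow> (real \<Rightarrow> 'a \<Rightarrow> real) \<Rightarrow> bool" where
  "super_diffusion M X \<longleftrightarrow>
     filterlim (\<lambda>t. prob_space.variance M (X t) / t) at_top at_top"

end

theory Submission
  imports Defs
begin

text \<open>
  By the defining characteristic function, the law of \<open>\<omega> \<phi>\<close> depends only on the \<open>L\<^sup>2\<close> norm of
  \<open>\<phi>\<close>; with the linearity of \<open>\<omega>\<close>, the uniqueness theorem for characteristic functions makes it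
  centred and makes its second moment proportional to the squared norm of \<open>\<phi>\<close>.  The constant is
  finite because the process has an approximating sequence in \<open>L\<^sup>2\<close>, and non-zero because the
  Wright function, a Mellin-Barnes integral along a line with positive real part, tends to \<open>0\<close>
  at \<open>-\<infinity>\<close>.  Both facts pass to mean-square
  limits.  As the fractional operator maps the indicator of \<open>[0, t)\<close> to a multiple of
  \<open>(t - x)\<^sub>+\<close> to the power \<open>H - 1/2\<close> minus \<open>(-x)\<^sub>+\<close> to the same power, scaling gives a variance
  proportional to \<open>t powr (2 * H)\<close>.
\<close>

section \<open>Mean-square convergence\<close>

lemma square_integrable_diff:
  assumes "square_integrable M f" "square_integrable M g"
  shows "square_integrable M (\<lambda>x. f x - g x)"
proof -
  have [measurable]: "f \<in> borel_measurable M" "g \<in> borel_measurable M"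
    using assms by (auto simp: square_integrable_def)
  have "integrable M (\<lambda>x. 2 * (f x)\<^sup>2 + 2 * (g x)\<^sup>2)"
    using assms by (auto simp: square_integrable_def)
  then have "integrable M (\<lambda>x. (f x - g x)\<^sup>2)"
  proof (rule Bochner_Integration.integrable_bound)
    show "AE x in M. norm ((f x - g x)\<^sup>2) \<le> norm (2 * (f x)\<^sup>2 + 2 * (g x)\<^sup>2)"
    proof (intro always_eventually allI)
      fix x
      have "(f x - g x)\<^sup>2 + (f x + g x)\<^sup>2 = 2 * (f x)\<^sup>2 + 2 * (g x)\<^sup>2"
        by (simp add: power2_eq_square algebra_simps)
      then have "(f x - g x)\<^sup>2 \<le> 2 * (f x)\<^sup>2 + 2 * (g x)\<^sup>2"
        using zero_le_power2[of "f x + g x"] by linarith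
      then show "norm ((f x - g x)\<^sup>2) \<le> norm (2 * (f x)\<^sup>2 + 2 * (g x)\<^sup>2)"
        by simp
    qed
  qed simp
  then show ?thesis by (simp add: square_integrable_def)
qed

text \<open>Stated for an arbitrary measure because it is applied on both sides of the pairing: to
  \<open>lborel\<close> for the test functions and to the probability measure for the random
  variables. A weighted Young inequality takes the place of Cauchy-Schwarz.\<close>

lemma L2_tendsto_integral_square:
  assumes "L2_tendsto M F f"
  shows "(\<lambda>n. LINT x|M. (F n x)\<^sup>2) \<longlonglongrightarrow> (LINT x|M. (f x)\<^sup>2)"
proof (rule LIMSEQ_I)
  fix e :: real assume "e > 0"
  define S where "S = (LINT x|M. (f x)\<^sup>2)"
  define D where "D n = (LINT x|M. (F n x - f x)\<^sup>2)" for n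
  have S: "S \<ge> 0" by (simp add: S_def)
  \<comment> \<open>The weight \<open>\<delta>\<close> balances the cross term in \<open>F\<^sup>2 - f\<^sup>2 = (F - f)\<^sup>2 + 2 f (F - f)\<close>.\<close>
  define \<delta> where "\<delta> = e / (2 * (S + 1))"
  have \<delta>: "\<delta> > 0" using \<open>e > 0\<close> S by (simp add: \<delta>_def)
  \<comment> \<open>The \<open>+ 1\<close> in the denominator of \<open>\<delta>\<close> covers
    \<open>S = 0\<close> and makes this inequality strict.\<close>
  have \<delta>S: "\<delta> * S < e / 2" using \<open>e > 0\<close> S by (simp add: \<delta>_def field_simps)
  have F: "square_integrable M (F n)" and f: "square_integrable M f" and D0: "D \<longlonglongrightarrow> 0" for n
    using assms by (auto simp: L2_tendsto_def D_def[abs_def])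
  have bound: "\<bar>(LINT x|M. (F n x)\<^sup>2) - S\<bar> \<le> (1 + 1 / \<delta>) * D n + \<delta> * S" for n
  proof -
    have iF: "integrable M (\<lambda>x. (F n x)\<^sup>2)" and if': "integrable M (\<lambda>x. (f x)\<^sup>2)"
      and id: "integrable M (\<lambda>x. (F n x - f x)\<^sup>2)"
      using F f square_integrable_diff[OF F f] by (auto simp: square_integrable_def)
    have pw: "\<bar>(F n x)\<^sup>2 - (f x)\<^sup>2\<bar> \<le> (1 + 1 / \<delta>) * (F n x - f x)\<^sup>2 + \<delta> * (f x)\<^sup>2" for x
    proof -
      define d where "d = F n x - f x"
      have "0 \<le> (\<delta> * \<bar>f x\<bar> - \<bar>d\<bar>)\<^sup>2 / \<delta>" using \<delta> by simp
      also have "\<dots> = \<delta> * (f x)\<^sup>2 + d\<^sup>2 / \<delta> - 2 * \<bar>f x * d\<bar>"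
        using \<delta> by (simp add: power2_eq_square field_simps abs_mult flip: power2_abs)
      finally have "2 * \<bar>f x * d\<bar> \<le> \<delta> * (f x)\<^sup>2 + d\<^sup>2 / \<delta>" by simp
      moreover have "(F n x)\<^sup>2 - (f x)\<^sup>2 = d\<^sup>2 + 2 * (f x * d)"
        by (simp add: d_def power2_eq_square algebra_simps)
      moreover have "\<bar>d\<^sup>2 + 2 * (f x * d)\<bar> \<le> d\<^sup>2 + 2 * \<bar>f x * d\<bar>"
        using zero_le_power2[of d] by linarith
      ultimately show ?thesis by (simp add: d_def algebra_simps)
    qed
    have "(LINT x|M. (F n x)\<^sup>2) - S = (LINT x|M. (F n x)\<^sup>2 - (f x)\<^sup>2)"
      unfolding S_def using iF if' by simp
    also have "\<bar>\<dots>\<bar> \<le> (LINT x|M. \<bar>(F n x)\<^sup>2 - (f x)\<^sup>2\<bar>)"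
      by (rule integral_abs_bound)
    also have "\<dots> \<le> (LINT x|M. (1 + 1 / \<delta>) * (F n x - f x)\<^sup>2 + \<delta> * (f x)\<^sup>2)"
      using iF if' id pw by (intro integral_mono) auto
    also have "\<dots> = (1 + 1 / \<delta>) * D n + \<delta> * S"
      using if' id by (simp add: S_def D_def)
    finally show ?thesis .
  qed
  have "(\<lambda>n. (1 + 1 / \<delta>) * D n) \<longlonglongrightarrow> (1 + 1 / \<delta>) * 0"
    by (intro tendsto_intros D0)
  then have "eventually (\<lambda>n. (1 + 1 / \<delta>) * D n < e / 2) sequentially"
    using \<open>e > 0\<close> by (auto dest!: order_tendstoD(2)[where a = "e / 2"])
  then have "eventually (\<lambda>n. norm ((LINT x|M. (F n x)\<^sup>2) - S) < e) sequentially"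
  proof eventually_elim
    case (elim n)
    have "norm ((LINT x|M. (F n x)\<^sup>2) - S) \<le> (1 + 1 / \<delta>) * D n + \<delta> * S"
      using bound[of n] by simp
    also have "(1 + 1 / \<delta>) * D n + \<delta> * S < e / 2 + e / 2"
      using elim \<delta>S by (rule add_strict_mono)
    finally show ?case by simp
  qed
  then show "\<exists>N. \<forall>n\<ge>N. norm ((LINT x|M. (F n x)\<^sup>2) - (LINT x|M. (f x)\<^sup>2)) < e"
    by (simp only: S_def eventually_sequentially)
qed

lemma (in finite_measure) square_integrable_integrable:
  assumes "square_integrable M f"
  shows "integrable M f"
  using assms by (intro square_integrable_imp_integrable[of f]) (simp_all add: square_integrable_def)

text \<open>The squared mean of \<open>F n - f\<close> is at most its second moment, since the
  variance of the difference is nonnegative.\<close>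

lemma (in prob_space) L2_tendsto_expectation:
  assumes "L2_tendsto M F f"
  shows "(\<lambda>n. expectation (F n)) \<longlonglongrightarrow> expectation f"
proof -
  have F: "square_integrable M (F n)" and f: "square_integrable M f" for n
    using assms by (auto simp: L2_tendsto_def)
  have bound: "(expectation (F n) - expectation f)\<^sup>2 \<le> expectation (\<lambda>x. (F n x - f x)\<^sup>2)" for n
  proof -
    have d: "square_integrable M (\<lambda>x. F n x - f x)" by (rule square_integrable_diff[OF F f])
    have "0 \<le> variance (\<lambda>x. F n x - f x)" by (rule variance_positive)
    also have "\<dots> = expectation (\<lambda>x. (F n x - f x)\<^sup>2) - (expectation (\<lambda>x. F n x - f x))\<^sup>2"
      using square_integrable_integrable[OF d] d
      by (intro variance_eq) (simp_all add: square_integrable_def)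
    also have "expectation (\<lambda>x. F n x - f x) = expectation (F n) - expectation f"
      by (intro Bochner_Integration.integral_diff square_integrable_integrable F f)
    finally show ?thesis by simp
  qed
  have "(\<lambda>n. expectation (\<lambda>x. (F n x - f x)\<^sup>2)) \<longlonglongrightarrow> 0"
    using assms by (auto simp: L2_tendsto_def)
  then have "(\<lambda>n. (expectation (F n) - expectation f)\<^sup>2) \<longlonglongrightarrow> 0"
    by (rule Lim_null_comparison[rotated]) (simp add: bound)
  then have "(\<lambda>n. expectation (F n) - expectation f) \<longlonglongrightarrow> 0"
    by (rule power_tendsto_0_iff[THEN iffD1, rotated]) simp
  then show ?thesis by (simp add: LIM_zero_iff)
qed

section \<open>Scaling in the law of the pairing\<close>

lemma schwartz_scale:
  assumes "f \<in> schwartz"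
  shows "(\<lambda>x. a * f x) \<in> schwartz"
proof -
  have diff: "(deriv ^^ n) f differentiable_on UNIV" for n
    using assms by (simp add: schwartz_def)
  then have fd: "(deriv ^^ n) f field_differentiable at x" for n x
    by (simp add: differentiable_on_def real_differentiable_def field_differentiable_def)
  have eq: "(deriv ^^ n) (\<lambda>x. a * f x) = (\<lambda>x. a * (deriv ^^ n) f x)" for n
    by (induction n) (simp_all add: deriv_cmult[OF fd])
  have "bounded (range (\<lambda>x. x ^ k * (a * (deriv ^^ n) f x)))" for k n
  proof -
    have "bounded ((\<lambda>y. a *\<^sub>R y) ` range (\<lambda>x. x ^ k * (deriv ^^ n) f x))"
      using assms by (intro bounded_scaling) (auto simp: schwartz_def)
    then show ?thesis by (simp add: image_image ac_simps)
  qed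
  moreover have "(\<lambda>x. a * (deriv ^^ n) f x) differentiable_on UNIV" for n
    using diff by (intro derivative_intros)
  ultimately show ?thesis by (simp add: schwartz_def eq)
qed

lemma tempered_scale:
  assumes "\<omega> \<in> tempered" "f \<in> schwartz"
  shows "\<omega> (\<lambda>x. a * f x) = a * \<omega> f"
proof -
  have "\<omega> (\<lambda>x. a * f x + 0 * f x) = a * \<omega> f + 0 * \<omega> f"
    using assms unfolding tempered_def by blast
  then show ?thesis by simp
qed

text \<open>Homogeneity of \<open>\<omega>\<close> moves the factor \<open>\<xi> * r\<close> into
  the test function, so the defining identity of the measure, evaluated at multiples of a single
  \<open>\<phi>\<close>, yields the whole characteristic function.\<close>

lemma char_pairing:
  assumes M: "fox_H_measure A B c M" and \<phi>: "\<phi> \<in> schwartz"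
    and meas: "(\<lambda>\<omega>. \<omega> \<phi>) \<in> borel_measurable M"
  shows "char (distr M borel (\<lambda>\<omega>. r * \<omega> \<phi>)) \<xi> =
    1 / of_real (K_const A B) * wright_neg A B c ((\<xi> * r)\<^sup>2 / 2 * (LINT x|lborel. \<phi> x * \<phi> x))"
proof -
  have [measurable]: "(\<lambda>\<omega>. r * \<omega> \<phi>) \<in> borel_measurable M" using meas by measurable
  have "char (distr M borel (\<lambda>\<omega>. r * \<omega> \<phi>)) \<xi> = (CLINT \<omega>|M. iexp (\<xi> * (r * \<omega> \<phi>)))"
    unfolding char_def by (subst integral_distr) auto
  also have "\<dots> = (CLINT \<omega>|M. iexp (\<omega> (\<lambda>x. (\<xi> * r) * \<phi> x)))"
  proof (intro Bochner_Integration.integral_cong refl)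
    fix \<omega> assume "\<omega> \<in> space M"
    then have "\<omega> \<in> tempered" using M by (simp add: fox_H_measure_def)
    then have "\<xi> * (r * \<omega> \<phi>) = \<omega> (\<lambda>x. (\<xi> * r) * \<phi> x)"
      by (simp only: tempered_scale[OF _ \<phi>] mult.assoc[of \<xi> r "\<omega> \<phi>"])
    then show "iexp (\<xi> * (r * \<omega> \<phi>)) = iexp (\<omega> (\<lambda>x. (\<xi> * r) * \<phi> x))"
      by (rule arg_cong)
  qed
  also have "\<dots> = 1 / of_real (K_const A B) *
      wright_neg A B c (1/2 * (LINT x|lborel. ((\<xi> * r) * \<phi> x) * ((\<xi> * r) * \<phi> x)))"
    using M schwartz_scale[OF \<phi>, of "\<xi> * r"] unfolding fox_H_measure_def by blast
  also have "(LINT x|lborel. ((\<xi> * r) * \<phi> x) * ((\<xi> * r) * \<phi> x)) =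
      (LINT x|lborel. (\<xi> * r)\<^sup>2 * (\<phi> x * \<phi> x))"
    by (intro Bochner_Integration.integral_cong) (auto simp: power2_eq_square)
  also have "\<dots> = (\<xi> * r)\<^sup>2 * (LINT x|lborel. \<phi> x * \<phi> x)"
    by (rule integral_mult_right_zero)
  finally show ?thesis by (simp add: mult.assoc)
qed

text \<open>Both characteristic functions have the same Wright argument at every frequency. The sign
  of \<open>r\<close> is free: \<open>r = -1\<close> gives symmetry of the law, and a quotient of
  norms gives the comparison of second moments.\<close>

lemma distr_pairing_scale:
  assumes M: "fox_H_measure A B c M" and \<phi>: "\<phi> \<in> schwartz" and \<psi>: "\<psi> \<in> schwartz"
    and m\<phi>: "(\<lambda>\<omega>. \<omega> \<phi>) \<in> borel_measurable M" and m\<psi>: "(\<lambda>\<omega>. \<omega> \<psi>) \<in> borel_measurable M"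
    and eq: "(LINT x|lborel. \<psi> x * \<psi> x) = r\<^sup>2 * (LINT x|lborel. \<phi> x * \<phi> x)"
  shows "distr M borel (\<lambda>\<omega>. \<omega> \<psi>) = distr M borel (\<lambda>\<omega>. r * \<omega> \<phi>)"
proof (rule Levy_uniqueness)
  interpret prob_space M using M by (simp add: fox_H_measure_def)
  show "real_distribution (distr M borel (\<lambda>\<omega>. \<omega> \<psi>))"
    "real_distribution (distr M borel (\<lambda>\<omega>. r * \<omega> \<phi>))"
    using m\<phi> m\<psi> by (auto intro!: real_distribution_distr)
  show "char (distr M borel (\<lambda>\<omega>. \<omega> \<psi>)) = char (distr M borel (\<lambda>\<omega>. r * \<omega> \<phi>))"
    using char_pairing[OF M \<psi> m\<psi>, of 1] char_pairing[OF M \<phi> m\<phi>, of r]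
    by (auto simp: fun_eq_iff eq power_mult_distrib mult_ac)
qed

text \<open>The law is symmetric. If the pairing is not integrable, the integral has the default
  value 0, in agreement with the claim.\<close>

lemma pairing_mean_zero:
  assumes M: "fox_H_measure A B c M" and \<phi>: "\<phi> \<in> schwartz"
    and m[measurable]: "(\<lambda>\<omega>. \<omega> \<phi>) \<in> borel_measurable M"
  shows "(LINT \<omega>|M. \<omega> \<phi>) = 0"
proof -
  have "distr M borel (\<lambda>\<omega>. \<omega> \<phi>) = distr M borel (\<lambda>\<omega>. (-1) * \<omega> \<phi>)"
    by (rule distr_pairing_scale[OF M \<phi> \<phi> m m]) simp
  then have "(LINT x|distr M borel (\<lambda>\<omega>. \<omega> \<phi>). x) = (LINT x|distr M borel (\<lambda>\<omega>. (-1) * \<omega> \<phi>). x)"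
    by simp
  then have "(LINT \<omega>|M. \<omega> \<phi>) = (LINT \<omega>|M. (-1) * \<omega> \<phi>)"
    by (subst (asm) (1 2) integral_distr) auto
  then show ?thesis by simp
qed

text \<open>With \<open>\<phi>\<close> as a fixed reference function, the quotient on the right is
  the squared constant relating the two norms.\<close>

lemma pairing_second_moment_scale:
  assumes M: "fox_H_measure A B c M" and \<phi>: "\<phi> \<in> schwartz" and \<psi>: "\<psi> \<in> schwartz"
    and m\<phi>[measurable]: "(\<lambda>\<omega>. \<omega> \<phi>) \<in> borel_measurable M"
    and m\<psi>[measurable]: "(\<lambda>\<omega>. \<omega> \<psi>) \<in> borel_measurable M"
    and pos: "(LINT x|lborel. (\<phi> x)\<^sup>2) > 0"
  shows "(LINT \<omega>|M. (\<omega> \<psi>)\<^sup>2) =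
    (LINT \<omega>|M. (\<omega> \<phi>)\<^sup>2) / (LINT x|lborel. (\<phi> x)\<^sup>2) * (LINT x|lborel. (\<psi> x)\<^sup>2)"
proof -
  \<comment> \<open>Chosen so that \<open>r\<close> times \<open>\<phi>\<close> has the same norm in
    \<open>lborel\<close> as \<open>\<psi>\<close>.\<close>
  define r where "r = sqrt ((LINT x|lborel. (\<psi> x)\<^sup>2) / (LINT x|lborel. (\<phi> x)\<^sup>2))"
  have r2: "r\<^sup>2 = (LINT x|lborel. (\<psi> x)\<^sup>2) / (LINT x|lborel. (\<phi> x)\<^sup>2)"
    unfolding r_def by (intro real_sqrt_pow2 divide_nonneg_nonneg) auto
  have "distr M borel (\<lambda>\<omega>. \<omega> \<psi>) = distr M borel (\<lambda>\<omega>. r * \<omega> \<phi>)"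
    by (rule distr_pairing_scale[OF M \<phi> \<psi> m\<phi> m\<psi>])
      (use r2 pos in \<open>simp add: power2_eq_square[symmetric]\<close>)
  then have "(LINT x|distr M borel (\<lambda>\<omega>. \<omega> \<psi>). x\<^sup>2) =
      (LINT x|distr M borel (\<lambda>\<omega>. r * \<omega> \<phi>). x\<^sup>2)"
    by simp
  then have "(LINT \<omega>|M. (\<omega> \<psi>)\<^sup>2) = (LINT \<omega>|M. (r * \<omega> \<phi>)\<^sup>2)"
    by (subst (asm) (1 2) integral_distr) auto
  also have "\<dots> = r\<^sup>2 * (LINT \<omega>|M. (\<omega> \<phi>)\<^sup>2)"
    by (simp add: power_mult_distrib)
  finally show ?thesis by (simp add: r2)
qed

section \<open>Decay of the Wright function and non-degeneracy of the pairing\<close>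

text \<open>
  The modulus of \<open>s powr (- u)\<close> is constant on the line, so the bound needs no convergence
  hypothesis: a divergent integral has the value \<open>0\<close>.
\<close>

lemma wright_neg_tendsto_0:
  assumes "c > 0"
  shows "(wright_neg A B c \<longlongrightarrow> 0) at_top"
proof -
  define G where "G y = Gamma (Complex c y) * gamma_ratio A B (1 - Complex c y)" for y
  define L where "L = (LINT y|lborel. norm (G y)) / (2 * pi)"
  have bound: "norm (wright_neg A B c s) \<le> L * s powr (- c)" if "s > 0" for s
  proof -
    have "norm (LINT y|lborel. G y * of_real s powr (- Complex c y) * \<i>) \<le>
        (LINT y|lborel. norm (G y * of_real s powr (- Complex c y) * \<i>))"
      by (rule integral_norm_bound)
    also have "\<dots> = (LINT y|lborel. norm (G y) * s powr (- c))"
      using that by (simp add: norm_mult norm_powr_real_powr)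
    also have "\<dots> = (LINT y|lborel. norm (G y)) * s powr (- c)"
      by (rule integral_mult_left_zero)
    finally show ?thesis
      using that by (simp add: wright_neg_def vertical_integral_def G_def L_def norm_mult
          norm_divide field_simps)
  qed
  have "((\<lambda>s. L * s powr (- c)) \<longlongrightarrow> L * 0) at_top"
    using assms by (intro tendsto_intros tendsto_neg_powr filterlim_ident) auto
  then show ?thesis
    by (intro Lim_null_comparison[OF eventually_mono[OF eventually_gt_at_top[of 0] bound]]) auto
qed

text \<open>A vanishing second moment would make the pairing almost surely 0 and its characteristic
  function constantly 1. The normalized Wright function would then be 1 on the whole negative
  half-line, against its decay.\<close>

lemma pairing_second_moment_pos:
  assumes M: "fox_H_measure A B c M" and "c > 0" and \<phi>: "\<phi> \<in> schwartz"
    and sq: "square_integrable M (\<lambda>\<omega>. \<omega> \<phi>)"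
    and pos: "(LINT x|lborel. (\<phi> x)\<^sup>2) > 0"
  shows "(LINT \<omega>|M. (\<omega> \<phi>)\<^sup>2) > 0"
proof (rule ccontr)
  assume "\<not> (LINT \<omega>|M. (\<omega> \<phi>)\<^sup>2) > 0"
  moreover have "(LINT \<omega>|M. (\<omega> \<phi>)\<^sup>2) \<ge> 0" by simp
  ultimately have "(LINT \<omega>|M. (\<omega> \<phi>)\<^sup>2) = 0" by linarith
  then have AE: "AE \<omega> in M. \<omega> \<phi> = 0"
    using sq by (subst (asm) integral_nonneg_eq_0_iff_AE) (auto simp: square_integrable_def)
  interpret prob_space M using M by (simp add: fox_H_measure_def)
  have m[measurable]: "(\<lambda>\<omega>. \<omega> \<phi>) \<in> borel_measurable M"
    using sq by (simp add: square_integrable_def)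
  define N where "N = (LINT x|lborel. \<phi> x * \<phi> x)"
  have N: "N > 0" using pos by (simp add: N_def power2_eq_square)
  have "1 / of_real (K_const A B) * wright_neg A B c s = 1" if "s \<ge> 0" for s
  proof -
    \<comment> \<open>Since \<open>N > 0\<close>, every \<open>s >= 0\<close> is the Wright argument
      at some frequency; this one solves for it.\<close>
    define \<xi> where "\<xi> = sqrt (2 * s / N)"
    have \<xi>: "\<xi>\<^sup>2 / 2 * N = s" using that N by (simp add: \<xi>_def)
    have "char (distr M borel (\<lambda>\<omega>. 1 * \<omega> \<phi>)) \<xi> = (CLINT \<omega>|M. iexp (\<xi> * \<omega> \<phi>))"
      unfolding char_def by (subst integral_distr) auto
    also have "\<dots> = (CLINT \<omega>|M. 1)"
      using AE by (intro integral_cong_AE) auto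
    finally show ?thesis
      using \<xi> by (simp only: char_pairing[OF M \<phi> m]) (simp add: N_def prob_space)
  qed
  then have ev: "eventually (\<lambda>s. 1 / of_real (K_const A B) * wright_neg A B c s = 1) at_top"
    by (intro eventually_mono[OF eventually_ge_at_top[of 0]])
  have "((\<lambda>s. 1 / of_real (K_const A B) * wright_neg A B c s) \<longlongrightarrow>
      1 / of_real (K_const A B) * 0) at_top"
    by (intro tendsto_intros wright_neg_tendsto_0 \<open>c > 0\<close>)
  then have "((\<lambda>s. 1 :: complex) \<longlongrightarrow> 0) (at_top :: real filter)"
    by (simp only: tendsto_cong[OF ev] mult_zero_right)
  then show False by (simp add: tendsto_const_iff)
qed

text \<open>The reference function \<open>\<phi>\<close> is independent of \<open>f\<close> and
  \<open>Y\<close>, so one constant serves all times of the process. Zero mean and proportionality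
  of second moments both survive the mean-square limit.\<close>

lemma extended_pairing_variance:
  assumes M: "fox_H_measure A B c M" and \<phi>: "\<phi> \<in> schwartz"
    and m\<phi>: "(\<lambda>\<omega>. \<omega> \<phi>) \<in> borel_measurable M"
    and pos: "(LINT x|lborel. (\<phi> x)\<^sup>2) > 0"
    and Y: "extended_pairing M f Y"
  shows "prob_space.variance M Y =
    (LINT \<omega>|M. (\<omega> \<phi>)\<^sup>2) / (LINT x|lborel. (\<phi> x)\<^sup>2) * (LINT x|lborel. (f x)\<^sup>2)"
proof -
  interpret prob_space M using M by (simp add: fox_H_measure_def)
  obtain \<psi> where \<psi>: "\<And>n. \<psi> n \<in> schwartz" and f: "L2_tendsto lborel \<psi> f"
    and L2: "L2_tendsto M (\<lambda>n \<omega>. \<omega> (\<psi> n)) Y"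
    using Y by (auto simp: extended_pairing_def)
  have m\<psi>: "(\<lambda>\<omega>. \<omega> (\<psi> n)) \<in> borel_measurable M" for n
    using L2 by (auto simp: L2_tendsto_def square_integrable_def)
  have "expectation Y = 0"
    using L2_tendsto_expectation[OF L2] pairing_mean_zero[OF M \<psi> m\<psi>]
    by (simp add: LIMSEQ_const_iff)
  then have "variance Y = expectation (\<lambda>\<omega>. (Y \<omega>)\<^sup>2)" by simp
  moreover have "(\<lambda>n. expectation (\<lambda>\<omega>. (\<omega> (\<psi> n))\<^sup>2)) \<longlonglongrightarrow> 
      (LINT \<omega>|M. (\<omega> \<phi>)\<^sup>2) / (LINT x|lborel. (\<phi> x)\<^sup>2) * (LINT x|lborel. (f x)\<^sup>2)"
    unfolding pairing_second_moment_scale[OF M \<phi> \<psi> m\<phi> m\<psi> pos]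
    by (intro tendsto_intros L2_tendsto_integral_square[OF f])
  ultimately show ?thesis
    using LIMSEQ_unique[OF L2_tendsto_integral_square[OF L2]] by simp
qed

section \<open>The fractional operator on indicator functions\<close>

text \<open>The truncation \<open>max 0 z\<close> includes \<open>z <= 0\<close>, where the interval
  is empty and the value is 0.\<close>

lemma has_bochner_integral_powr_from_0:
  fixes a z :: real
  assumes "a > -1"
  shows "has_bochner_integral lborel (\<lambda>s. indicator {0<..<z} s * s powr a)
    (max 0 z powr (a + 1) / (a + 1))"
proof -
  have "((\<lambda>s. s powr a) has_integral (max 0 z powr (a + 1) / (a + 1))) {0..max 0 z}"
    using assms by (intro has_integral_powr_from_0) auto
  \<comment> \<open>Nonnegativity of the integrand turns the gauge integral into a Lebesgue
    integral.\<close>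
  from nn_integral_has_integral_lebesgue[OF _ this]
  have nn: "(\<integral>\<^sup>+s. ennreal (indicator {0..max 0 z} s * s powr a) \<partial>lborel) =
      ennreal (max 0 z powr (a + 1) / (a + 1))"
    by simp
  have int: "has_bochner_integral lborel (\<lambda>s. indicator {0..max 0 z} s * s powr a)
      (max 0 z powr (a + 1) / (a + 1))"
    using assms nn by (intro has_bochner_integral_nn_integral) auto
  have "AE s in lborel. indicat_real {0..max 0 z} s * s powr a = indicator {0<..<z} s * s powr a"
    using AE_lborel_singleton[of z] AE_lborel_singleton[of 0]
    by eventually_elim (auto simp: indicator_def max_def split: if_splits)
  then show ?thesis
    by (rule has_bochner_integral_cong_AE[THEN iffD1, OF _ _ _ int, rotated 2]) measurable
qed

text \<open>As \<open>t >= 0\<close>, the part of \<open>{0..<t}\<close> above \<open>y\<close> is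
  \<open>{y<..<t}\<close> without \<open>{y<..<0}\<close>. Translated by \<open>y\<close>, both
  intervals start at 0, and the truncations absorb every position of \<open>y\<close>. The exponent
  \<open>a\<close> is \<open>- \<sigma>\<close> for the fractional derivative and
  \<open>\<sigma> - 1\<close> for the fractional integral.\<close>

lemma weyl_integral_indicator:
  fixes a y t :: real
  assumes a: "a > -1" and t: "t \<ge> 0"
  shows "(LINT s:{y<..}|lborel. indicat_real {0..<t} s * (s - y) powr a) =
    (max 0 (t - y) powr (a + 1) - max 0 (- y) powr (a + 1)) / (a + 1)"
proof -
  have shift: "has_bochner_integral lborel (\<lambda>s. indicator {0<..<z} (s - y) * (s - y) powr a)
      (max 0 z powr (a + 1) / (a + 1))" for z
    using lborel_has_bochner_integral_real_affine_iff[of 1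
        "\<lambda>s. indicator {0<..<z} s * s powr a" _ "- y"] has_bochner_integral_powr_from_0[OF a, of z]
    by simp
  have "has_bochner_integral lborel (\<lambda>s. indicator {0<..<t - y} (s - y) * (s - y) powr a -
      indicator {0<..<- y} (s - y) * (s - y) powr a)
      (max 0 (t - y) powr (a + 1) / (a + 1) - max 0 (- y) powr (a + 1) / (a + 1))"
    by (intro has_bochner_integral_diff shift)
  moreover have "AE s in lborel. indicat_real {0<..<t - y} (s - y) * (s - y) powr a -
      indicator {0<..<- y} (s - y) * (s - y) powr a =
      indicator {y<..} s *\<^sub>R (indicator {0..<t} s * (s - y) powr a)"
    using AE_lborel_singleton[of 0]
    by eventually_elim (use t in \<open>auto simp: indicator_def\<close>)
  ultimately have "has_bochner_integral lborel
      (\<lambda>s. indicator {y<..} s *\<^sub>R (indicat_real {0..<t} s * (s - y) powr a))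
      (max 0 (t - y) powr (a + 1) / (a + 1) - max 0 (- y) powr (a + 1) / (a + 1))"
    by (subst has_bochner_integral_cong_AE[symmetric]) auto
  then show ?thesis
    unfolding set_lebesgue_integral_def
    by (simp add: has_bochner_integral_integral_eq diff_divide_distrib)
qed

text \<open>The summand \<open>1 / (2 * H)\<close> keeps the base of the power positive, whatever
  nonnegative value the integral has.\<close>

lemma K_hurst_pos:
  assumes "H > 0"
  shows "K_hurst H > 0"
proof -
  have "(LINT s:{0<..}|lborel. ((1 + s) powr (H - 1/2) - s powr (H - 1/2))\<^sup>2) \<ge> 0"
    unfolding set_lebesgue_integral_def by (intro integral_nonneg_AE) auto
  moreover have "1 / (2 * H) > 0" using assms by simp
  ultimately have "(LINT s:{0<..}|lborel. ((1 + s) powr (H - 1/2) - s powr (H - 1/2))\<^sup>2)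
      + 1 / (2 * H) > 0" by linarith
  then show ?thesis
    using assms by (auto simp: K_hurst_def intro!: mult_pos_pos Gamma_real_pos)
qed

text \<open>
  As \<open>0 powr a = 0\<close> even for \<open>a \<le> 0\<close>, the formula covers all three cases of the operator.
\<close>

lemma M_minus_indicator:
  assumes H: "0 < H" "H < 1"
  obtains C where "C \<noteq> 0" and "\<And>t. t \<ge> 0 \<Longrightarrow> AE x in lborel.
    M_minus H (indicat_real {0..<t}) x =
      C * (max 0 (t - x) powr (H - 1/2) - max 0 (- x) powr (H - 1/2))"
proof (cases H "1/2 :: real" rule: linorder_cases)
  case less
  define \<sigma> where "\<sigma> = 1/2 - H"
  have \<sigma>: "0 < \<sigma>" "\<sigma> < 1" "H - 1/2 = - \<sigma>" using less H by (auto simp: \<sigma>_def)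
  \<comment> \<open>Differentiation produces \<open>- (1 - \<sigma>)\<close>: its modulus cancels
    the denominator of the primitive, and its sign cancels the minus in
    \<open>frac_deriv\<close>.\<close>
  define C where "C = K_hurst H / Gamma (1 - \<sigma>)"
  have "Gamma (1 - \<sigma>) > 0" using \<sigma> by (intro Gamma_real_pos) simp
  then have "C \<noteq> 0" using K_hurst_pos[of H] H by (simp add: C_def)
  moreover have "AE x in lborel. M_minus H (indicat_real {0..<t}) x =
      C * (max 0 (t - x) powr (H - 1/2) - max 0 (- x) powr (H - 1/2))" if t: "t \<ge> 0" for t
    using AE_lborel_singleton[of 0] AE_lborel_singleton[of t]
  proof eventually_elim
    fix x :: real assume x: "x \<noteq> 0" "x \<noteq> t"
    have der: "((\<lambda>y. max 0 (z - y) powr (1 - \<sigma>)) has_real_derivative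
        (- (1 - \<sigma>) * max 0 (z - x) powr (- \<sigma>))) (at x)" if "x \<noteq> z" for z
    proof (cases "x < z")
      case True
      have "((\<lambda>y. (z - y) powr (1 - \<sigma>)) has_real_derivative
          (- (1 - \<sigma>) * max 0 (z - x) powr (- \<sigma>))) (at x)"
        using True by (auto intro!: derivative_eq_intros simp: max_def algebra_simps)
      then show ?thesis
        by (rule has_field_derivative_transform_within_open[where S = "{..<z}"]) (use True in auto)
    next
      case False
      \<comment> \<open>To the right of \<open>z\<close> the function is locally 0, and the claimed
        derivative is 0 because \<open>0 powr (- \<sigma>) = 0\<close>.\<close>
      have "((\<lambda>y. 0) has_real_derivative (- (1 - \<sigma>) * max 0 (z - x) powr (- \<sigma>))) (at x)"
        using False that by (auto simp: max_def)
      then show ?thesis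
        by (rule has_field_derivative_transform_within_open[where S = "{z<..}"])
          (use False that in auto)
    qed
    \<comment> \<open>Writing \<open>0 - y\<close> makes the second power an instance of
      \<open>der\<close> with \<open>z = 0\<close>.\<close>
    have "((\<lambda>y. (max 0 (t - y) powr (1 - \<sigma>) - max 0 (0 - y) powr (1 - \<sigma>)) / (1 - \<sigma>))
        has_real_derivative
        (- (1 - \<sigma>) * max 0 (t - x) powr (- \<sigma>) - - (1 - \<sigma>) * max 0 (0 - x) powr (- \<sigma>)) / (1 - \<sigma>))
        (at x)"
      using x by (intro DERIV_cdivide DERIV_diff der)
    also have "(\<lambda>y. (max 0 (t - y) powr (1 - \<sigma>) - max 0 (0 - y) powr (1 - \<sigma>)) / (1 - \<sigma>)) =
        (\<lambda>y. LINT s:{y<..}|lborel. indicat_real {0..<t} s * (s - y) powr (- \<sigma>))"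
      using \<sigma> t by (simp add: weyl_integral_indicator)
    also have "(- (1 - \<sigma>) * max 0 (t - x) powr (- \<sigma>) - - (1 - \<sigma>) * max 0 (0 - x) powr (- \<sigma>)) /
        (1 - \<sigma>) = - (max 0 (t - x) powr (- \<sigma>) - max 0 (- x) powr (- \<sigma>))"
      using \<sigma> by (simp add: field_simps)
    finally have "deriv (\<lambda>y. LINT s:{y<..}|lborel. indicat_real {0..<t} s * (s - y) powr (- \<sigma>)) x =
        - (max 0 (t - x) powr (- \<sigma>) - max 0 (- x) powr (- \<sigma>))"
      by (rule DERIV_imp_deriv)
    then show "M_minus H (indicat_real {0..<t}) x =
        C * (max 0 (t - x) powr (H - 1/2) - max 0 (- x) powr (H - 1/2))"
      using less by (simp add: M_minus_def frac_deriv_def C_def right_diff_distrib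
          diff_divide_distrib flip: \<sigma>_def \<sigma>(3))
  qed
  ultimately show ?thesis by (rule that)
next
  case equal
  have H0: "H - 1/2 = 0" using equal by simp
  \<comment> \<open>With exponent 0, \<open>max 0 z powr 0\<close> is the indicator of
    \<open>z > 0\<close>, so the bracket is the indicator of \<open>x < t\<close> minus that of
    \<open>x < 0\<close>.\<close>
  have "M_minus H (indicat_real {0..<t}) x =
      1 * (max 0 (t - x) powr (H - 1/2) - max 0 (- x) powr (H - 1/2))" if "t \<ge> 0" "x \<noteq> 0" for t x
    using equal that unfolding M_minus_def H0 by (auto simp: indicator_def max_def)
  then have "AE x in lborel. M_minus H (indicat_real {0..<t}) x =
      1 * (max 0 (t - x) powr (H - 1/2) - max 0 (- x) powr (H - 1/2))" if "t \<ge> 0" for t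
    using AE_lborel_singleton[of 0] that by (auto elim: eventually_mono)
  then show ?thesis by (rule that[OF one_neq_zero])
next
  case greater
  define \<sigma> where "\<sigma> = H - 1/2"
  have \<sigma>: "0 < \<sigma>" using greater by (simp add: \<sigma>_def)
  \<comment> \<open>The extra factor \<open>\<sigma>\<close> is the denominator of the primitive of
    \<open>(s - x) powr (\<sigma> - 1)\<close>.\<close>
  define C where "C = K_hurst H / (Gamma \<sigma> * \<sigma>)"
  have "C > 0"
    unfolding C_def by (intro divide_pos_pos mult_pos_pos K_hurst_pos Gamma_real_pos \<sigma> H)
  then have "C \<noteq> 0" by simp
  moreover have "M_minus H (indicat_real {0..<t}) x =
      C * (max 0 (t - x) powr (H - 1/2) - max 0 (- x) powr (H - 1/2))" if "t \<ge> 0" for t x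
    using greater that \<sigma>
    by (simp add: M_minus_def frac_integral_def weyl_integral_indicator C_def flip: \<sigma>_def)
  ultimately show ?thesis by (intro that[of C]) auto
qed

text \<open>The squared kernel is homogeneous of degree \<open>2 * H - 1\<close> under joint scaling
  of \<open>t\<close> and \<open>x\<close>; the Jacobian of the substitution supplies one more power
  of \<open>t\<close>.\<close>

lemma M_minus_indicator_norm:
  assumes H: "0 < H" "H < 1"
    and sq: "square_integrable lborel (M_minus H (indicat_real {0..<1}))"
  obtains N where "N > 0" and "\<And>t. t > 0 \<Longrightarrow>
    square_integrable lborel (M_minus H (indicat_real {0..<t})) \<Longrightarrow>
    (LINT x|lborel. (M_minus H (indicat_real {0..<t}) x)\<^sup>2) = N * t powr (2 * H)"
proof -
  obtain C where C: "C \<noteq> 0" and eq: "\<And>t. t \<ge> 0 \<Longrightarrow> AE x in lborel.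
      M_minus H (indicat_real {0..<t}) x =
        C * (max 0 (t - x) powr (H - 1/2) - max 0 (- x) powr (H - 1/2))"
    by (rule M_minus_indicator[OF H]) (rule that)
  define h where
    "h t x = (C * (max 0 (t - x) powr (H - 1/2) - max 0 (- x) powr (H - 1/2)))\<^sup>2" for t x
  define N where "N = (LINT x|lborel. h 1 x)"
  have int: "(LINT x|lborel. (M_minus H (indicat_real {0..<t}) x)\<^sup>2) = (LINT x|lborel. h t x)"
    if "t \<ge> 0" "square_integrable lborel (M_minus H (indicat_real {0..<t}))" for t
    using eq[OF that(1)] that(2)
    by (intro integral_cong_AE) (auto simp: h_def square_integrable_def)
  have scale: "(LINT x|lborel. h t x) = N * t powr (2 * H)" if t: "t > 0" for t
  proof -
    have g: "max 0 (t * z) powr (H - 1/2) = t powr (H - 1/2) * max 0 z powr (H - 1/2)" for z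
    proof -
      have "max 0 (t * z) = t * max 0 z" using t by (auto simp: max_def zero_le_mult_iff)
      then show ?thesis using t by (simp add: powr_mult)
    qed
    have ht: "h t (0 + t * x) = t powr (2 * H - 1) * h 1 x" for x
    proof -
      have "t - t * x = t * (1 - x)" "- (t * x) = t * (- x)" by (simp_all add: algebra_simps)
      then have "h t (0 + t * x) = (t powr (H - 1/2))\<^sup>2 * h 1 x"
        unfolding h_def by (simp only: add_0 g) (simp add: power2_eq_square algebra_simps)
      also have "(t powr (H - 1/2))\<^sup>2 = t powr (2 * H - 1)"
        using t by (simp add: power2_eq_square flip: powr_add)
      finally show ?thesis .
    qed
    have "(LINT x|lborel. h t x) = \<bar>t\<bar> *\<^sub>R (LINT x|lborel. h t (0 + t * x))"
      using t by (intro lborel_integral_real_affine) auto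
    also have "\<dots> = t * (t powr (2 * H - 1) * N)"
      using t by (simp only: ht) (simp add: N_def)
    also have "\<dots> = N * t powr (2 * H)"
      using t by (simp add: powr_diff)
    finally show ?thesis .
  qed
  \<comment> \<open>Integrability excludes the default value of the integral, so that
    \<open>N = 0\<close> forces \<open>h 1\<close> to vanish almost everywhere.\<close>
  have inth: "integrable lborel (h 1)"
  proof -
    have "integrable lborel (\<lambda>x. (M_minus H (indicat_real {0..<1}) x)\<^sup>2)"
      using sq by (simp add: square_integrable_def)
    moreover have "h 1 \<in> borel_measurable lborel" unfolding h_def by measurable
    ultimately show ?thesis
      by (rule integrable_cong_AE_imp) (use eq[of 1] in \<open>auto simp: h_def\<close>)
  qed
  have "N \<noteq> 0"
  proof
    assume "N = 0"
    then have "AE x in lborel. h 1 x = 0"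
      using inth unfolding N_def
      by (subst (asm) integral_nonneg_eq_0_iff_AE) (auto simp: h_def)
    \<comment> \<open>On \<open>(0, 1)\<close> the second power is 0 and the first is positive, so
      \<open>h 1\<close> has no zero there.\<close>
    then have "AE x in lborel. \<not> (0 < x \<and> x < (1::real))"
      by eventually_elim (use C in \<open>auto simp: h_def max_def\<close>)
    then have "{0<..<1::real} \<in> null_sets lborel"
      by (subst AE_iff_null_sets) auto
    then show False by (auto simp: null_sets_def)
  qed
  moreover have "N \<ge> 0" by (auto simp: N_def h_def)
  ultimately have "N > 0" by simp
  then show ?thesis using int scale by (intro that[of N]) auto
qed

section \<open>The diffusion type\<close>

text \<open>The approximating sequence at time 1 supplies the reference test function: its members
  are square integrable under \<open>M\<close>, and their norms tend to that of a nonzero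
  limit.\<close>

lemma fox_H_process_variance:
  assumes M: "fox_H_measure A B c M" and c: "c > 0" and H: "0 < H" "H < 1"
    and X: "fox_H_process M H X"
  obtains C where "C > 0" and
    "\<And>t. t > 0 \<Longrightarrow> prob_space.variance M (X t) = C * t powr (2 * H)"
proof -
  let ?f = "\<lambda>t. M_minus H (indicat_real {0..<t})"
  have ext: "extended_pairing M (?f t) (X t)" if "t > 0" for t
    using X that by (simp add: fox_H_process_def)
  then have sq: "square_integrable lborel (?f t)" if "t > 0" for t
    using that by (fastforce simp: extended_pairing_def L2_tendsto_def)
  obtain N where N: "N > 0"
    and norm: "\<And>t. t > 0 \<Longrightarrow> (LINT x|lborel. (?f t x)\<^sup>2) = N * t powr (2 * H)"
    using M_minus_indicator_norm[OF H sq[of 1]] sq by (metis zero_less_one)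
  obtain \<psi> where \<psi>: "\<And>n. \<psi> n \<in> schwartz" and L2f: "L2_tendsto lborel \<psi> (?f 1)"
    and L2: "L2_tendsto M (\<lambda>n \<omega>. \<omega> (\<psi> n)) (X 1)"
    using ext[of 1] by (auto simp: extended_pairing_def)
  have "(\<lambda>n. LINT x|lborel. (\<psi> n x)\<^sup>2) \<longlonglongrightarrow> N"
    using L2_tendsto_integral_square[OF L2f] norm[of 1] by simp
  then have "eventually (\<lambda>n. (LINT x|lborel. (\<psi> n x)\<^sup>2) > 0) sequentially"
    using N by (rule order_tendstoD(1))
  then obtain n where pos: "(LINT x|lborel. (\<psi> n x)\<^sup>2) > 0"
    by (auto simp: eventually_sequentially)
  have sqn: "square_integrable M (\<lambda>\<omega>. \<omega> (\<psi> n))" using L2 by (simp add: L2_tendsto_def)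
  define C where "C = (LINT \<omega>|M. (\<omega> (\<psi> n))\<^sup>2) / (LINT x|lborel. (\<psi> n x)\<^sup>2) * N"
  have "C > 0"
    using pairing_second_moment_pos[OF M c \<psi> sqn pos] pos N by (simp add: C_def)
  moreover have "prob_space.variance M (X t) = C * t powr (2 * H)" if "t > 0" for t
    using extended_pairing_variance[OF M \<psi> _ pos ext[OF that]] sqn norm[OF that]
    by (simp add: C_def square_integrable_def)
  ultimately show ?thesis by (rule that)
qed

theorem proposition4p3:
  fixes A B :: "(real \<times> real) list"
    and \<gamma> c H :: real
    and M :: "((real \<Rightarrow> real) \<Rightarrow> real) measure"
    and X :: "real \<Rightarrow> ((real \<Rightarrow> real) \<Rightarrow> real) \<Rightarrow> real"
  assumes "admissible_line B \<gamma>"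
    and "fox_H_parameters A B \<gamma>"
    and "admissible_wright_line B c"
    and "fox_H_measure A B c M"
    and "0 < H" and "H < 1"
    and "fox_H_process M H X"
  shows "(H < 1/2 \<longrightarrow> sub_diffusion M X) \<and>
         (H = 1/2 \<longrightarrow> normal_diffusion M X) \<and>
         (H > 1/2 \<longrightarrow> super_diffusion M X)"
proof -
  have "c > 0" using assms(3) by (simp add: admissible_wright_line_def)
  then obtain C where C: "C > 0"
    and var: "\<And>t. t > 0 \<Longrightarrow> prob_space.variance M (X t) = C * t powr (2 * H)"
    by (rule fox_H_process_variance[OF assms(4) _ assms(5-7)]) (rule that)
  \<comment> \<open>The sign of the exponent \<open>2 * H - 1\<close> separates the three
    regimes.\<close>
  have ev: "eventually (\<lambda>t. prob_space.variance M (X t) / t = C * t powr (2 * H - 1)) at_top"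
    using eventually_gt_at_top[of 0] by eventually_elim (simp only: var, simp add: powr_diff)
  have "sub_diffusion M X" if "H < 1/2"
  proof -
    have "((\<lambda>t. C * t powr (2 * H - 1)) \<longlongrightarrow> C * 0) at_top"
      using that by (intro tendsto_intros tendsto_neg_powr filterlim_ident) auto
    then show ?thesis by (simp add: sub_diffusion_def tendsto_cong[OF ev])
  qed
  moreover have "normal_diffusion M X" if "H = 1/2"
  proof -
    have "eventually (\<lambda>t. C * t powr (2 * H - 1) = C) at_top"
      using eventually_gt_at_top[of 0] by eventually_elim (simp add: that)
    then have "((\<lambda>t. C * t powr (2 * H - 1)) \<longlongrightarrow> C) at_top"
      by (rule tendsto_eventually)
    then show ?thesis
      using C by (auto simp: normal_diffusion_def tendsto_cong[OF ev])
  qed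
  moreover have "super_diffusion M X" if "H > 1/2"
  proof -
    \<comment> \<open>For \<open>t > 0\<close> the power is this exponential, whose argument tends
      to infinity since \<open>2 * H - 1 > 0\<close>.\<close>
    have "filterlim (\<lambda>t. exp ((2 * H - 1) * ln t)) at_top at_top"
      using that
      by (intro filterlim_compose[OF exp_at_top] ln_at_top
          filterlim_tendsto_pos_mult_at_top[OF tendsto_const]) auto
    moreover have "eventually (\<lambda>t. exp ((2 * H - 1) * ln t) = t powr (2 * H - 1)) at_top"
      using eventually_gt_at_top[of 0] by eventually_elim (simp add: powr_def)
    ultimately have "filterlim (\<lambda>t. t powr (2 * H - 1)) at_top at_top"
      by (simp only: filterlim_cong[OF refl refl])
    then have "filterlim (\<lambda>t. C * t powr (2 * H - 1)) at_top at_top"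
      using C by (intro filterlim_tendsto_pos_mult_at_top[OF tendsto_const])
    then show ?thesis
      by (simp add: super_diffusion_def filterlim_cong[OF refl refl ev])
  qed
  ultimately show ?thesis by blast
qed

end
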